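(* Let $p$ be any odd prime and let $x$ be a $p$-adic integer. Then $$\sum_{k=0}^{p-1}(-1)^kd_k(x)^2=\sum_{k=0}^{p-1}d_k(x)d_k(-1-x)\equiv(-1)^{\langle x\rangle_p}\pmod{p^2},$$ $$\sum_{k=0}^{p-1}d_k(x)^2=\sum_{k=0}^{p-1}(-1)^kd_k(x)d_k(-1-x)\equiv\begin{cases}\left(\frac{-1}{p}\right)\pmod{p^2}&\text{if } x\equiv-1/2\pmod p,\\ (-1)^{\langle x\rangle_p}\,\dfrac{p+2x-2\langle x\rangle_p}{2x+1}\pmod{p^2}&\text{otherwise},\end{cases}$$ and $$\sum_{k=0}^{p-1}(2k+1)d_k(x)^2\equiv\begin{cases}-x\pmod{p^2}&\text{if } x\equiv0\pmod p,\\ x+1\pmod{p^2}&\text{if } x\equiv-1\pmod p,\\ 0\pmod{p^2}&\text{otherwise}.\end{cases}$$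
   Context: For $n\in\{0,1,2,\ldots\}$, $d_n(x)=\sum_{k=0}^n\binom nk\binom xk2^k$, where $\binom xk=x(x-1)\cdots(x-k+1)/k!$. For a $p$-adic integer $x$, $\langle x\rangle_p$ denotes the least nonnegative integer $r$ with $x\equiv r\pmod p$. For $p$-adic numbers $a,b$, $a\equiv b\pmod{p^m}$ means $(a-b)/p^m$ is a $p$-adic integer. $\left(\frac{\cdot}{p}\right)$ is the Legendre symbol. *)

theory Defs
  imports
    "HOL-Computational_Algebra.Computational_Algebra"
    "HOL-Number_Theory.Number_Theory"
    "Berlekamp_Zassenhaus.Finite_Field"
begin

text \<open>
  The prime \<open>p\<close> is carried by a type \<open>'p\<close> of class \<open>prime_card\<close>, as \<open>p = CARD('p)\<close>.
  The ring of \<open>p\<close>-adic integers is the inverse limit of the rings of integers modulo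
  \<open>p ^ n\<close>: the \<open>n\<close>-th entry is the representative in \<open>{0..<p ^ n}\<close> of the
  residue class modulo \<open>p ^ n\<close>.
\<close>

typedef (overloaded) ('p :: prime_card) padic_int =
  "{f :: nat \<Rightarrow> int. \<forall>n. f n \<in> {0..<int CARD('p) ^ n} \<and> f (Suc n) mod int CARD('p) ^ n = f n}"
  morphisms padic_residue Abs_padic_int
  by (rule exI[of _ "\<lambda>_. 0"]) (simp add: prime_card prime_gt_0_nat)

setup_lifting type_definition_padic_int

lemma mod_power_Suc_mod: "a mod (c :: int) ^ Suc n mod c ^ n = a mod c ^ n"
  by (rule mod_mod_cancel) (simp add: le_imp_power_dvd)

lemma CARD_power_pos: "0 < int CARD('p :: prime_card) ^ n"
  by (simp add: prime_card prime_gt_0_nat)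

lemma padic_closed:
  fixes g :: "nat \<Rightarrow> int"
  assumes "\<And>n. g (Suc n) mod int CARD('p :: prime_card) ^ n = g n mod int CARD('p) ^ n"
  shows "g n mod int CARD('p) ^ n \<in> {0..<int CARD('p) ^ n} \<and>
    g (Suc n) mod int CARD('p) ^ Suc n mod int CARD('p) ^ n = g n mod int CARD('p) ^ n"
  using assms CARD_power_pos[where 'p = 'p] by (simp only: mod_power_Suc_mod) simp

lemma padic_residue_mod:
  "padic_residue x n mod int CARD('p) ^ n = padic_residue (x :: 'p :: prime_card padic_int) n"
  using padic_residue[of x] by simp

lemma padic_residue_Suc_mod:
  "padic_residue x (Suc n) mod int CARD('p) ^ n = padic_residue (x :: 'p :: prime_card padic_int) n"
  using padic_residue[of x] by simp

lemma padic_residue_add_mod: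
  "padic_residue x (n + k) mod int CARD('p) ^ n = padic_residue (x :: 'p :: prime_card padic_int) n"
proof (induction k)
  case 0
  show ?case by (simp add: padic_residue_mod)
next
  case (Suc k)
  have "padic_residue x (n + Suc k) mod int CARD('p) ^ n =
      padic_residue x (Suc (n + k)) mod int CARD('p) ^ (n + k) mod int CARD('p) ^ n"
    by (simp add: mod_mod_cancel le_imp_power_dvd)
  with Suc show ?case by (simp only: padic_residue_Suc_mod)
qed

instantiation padic_int :: (prime_card) comm_ring_1
begin

lift_definition zero_padic_int :: "'a padic_int" is "\<lambda>_. 0"
  by (simp add: CARD_power_pos)

lift_definition one_padic_int :: "'a padic_int" is "\<lambda>n. 1 mod int CARD('a) ^ n"
  by (rule padic_closed) simp

lift_definition plus_padic_int :: "'a padic_int \<Rightarrow> 'a padic_int \<Rightarrow> 'a padic_int"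
  is "\<lambda>f g n. (f n + g n) mod int CARD('a) ^ n"
  by (rule padic_closed) (metis mod_add_eq mod_mod_trivial)

lift_definition minus_padic_int :: "'a padic_int \<Rightarrow> 'a padic_int \<Rightarrow> 'a padic_int"
  is "\<lambda>f g n. (f n - g n) mod int CARD('a) ^ n"
  by (rule padic_closed) (metis mod_diff_eq mod_mod_trivial)

lift_definition uminus_padic_int :: "'a padic_int \<Rightarrow> 'a padic_int"
  is "\<lambda>f n. (- f n) mod int CARD('a) ^ n"
  by (rule padic_closed) (metis mod_minus_eq mod_mod_trivial)

lift_definition times_padic_int :: "'a padic_int \<Rightarrow> 'a padic_int \<Rightarrow> 'a padic_int"
  is "\<lambda>f g n. (f n * g n) mod int CARD('a) ^ n"
  by (rule padic_closed) (metis mod_mult_eq mod_mod_trivial)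

instance
proof
  show "(0 :: 'a padic_int) \<noteq> 1"
  proof
    assume "(0 :: 'a padic_int) = 1"
    then have "padic_residue (0 :: 'a padic_int) 1 = padic_residue (1 :: 'a padic_int) 1"
      by simp
    moreover have "1 < int CARD('a)"
      using prime_card_int prime_gt_1_int by blast
    ultimately show False
      by (simp add: zero_padic_int.rep_eq one_padic_int.rep_eq)
  qed
qed (transfer; simp add: fun_eq_iff mod_simps algebra_simps)+

end

instance padic_int :: (prime_card) idom
proof
  fix x y :: "'a padic_int"
  let ?p = "int CARD('a)"
  assume "x \<noteq> 0" "y \<noteq> 0"
  then obtain m n where m: "padic_residue x m \<noteq> 0" and n: "padic_residue y n \<noteq> 0"
    by (metis ext padic_residue_inject zero_padic_int.rep_eq)
  let ?a = "padic_residue x (m + n)" and ?b = "padic_residue y (m + n)"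
  have a: "\<not> ?p ^ m dvd ?a"
    using m padic_residue_add_mod[of x m n] by (simp add: dvd_eq_mod_eq_0)
  have b: "\<not> ?p ^ n dvd ?b"
    using n padic_residue_add_mod[of y n m] by (simp add: dvd_eq_mod_eq_0 add.commute)
  have p: "prime ?p"
    by (rule prime_card_int)
  have nz: "?a \<noteq> 0" "?b \<noteq> 0"
    using a b by auto
  have "multiplicity ?p ?a < m" "multiplicity ?p ?b < n"
    using a b nz p by (metis multiplicity_dvd' not_le)+
  then have "\<not> ?p ^ (m + n) dvd ?a * ?b"
    using nz p
    by (subst power_dvd_iff_le_multiplicity)
      (auto simp: prime_elem_multiplicity_mult_distrib prime_imp_prime_elem)
  then have "padic_residue (x * y) (m + n) \<noteq> padic_residue 0 (m + n)"
    by (simp add: times_padic_int.rep_eq zero_padic_int.rep_eq dvd_eq_mod_eq_0)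
  then show "x * y \<noteq> 0"
    by metis
qed

lemma padic_residue_of_nat:
  "padic_residue (of_nat k :: 'p :: prime_card padic_int) n = int k mod int CARD('p) ^ n"
  by (induction k) (simp_all add: zero_padic_int.rep_eq one_padic_int.rep_eq plus_padic_int.rep_eq mod_simps)

instance padic_int :: (prime_card) ring_char_0
proof
  show "inj (of_nat :: nat \<Rightarrow> 'a padic_int)"
  proof (rule injI)
    fix i j :: nat
    assume "(of_nat i :: 'a padic_int) = of_nat j"
    then have eq: "int i mod int CARD('a) ^ (i + j) = int j mod int CARD('a) ^ (i + j)"
      by (metis padic_residue_of_nat)
    have "1 < CARD('a)"
      using prime_card prime_gt_1_nat by blast
    then have "i + j < CARD('a) ^ (i + j)"
      by (simp add: power_gt_expt)
    then have "int i + int j < int CARD('a) ^ (i + j)"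
      by (metis of_nat_add of_nat_less_iff of_nat_power)
    then have "int i mod int CARD('a) ^ (i + j) = int i" "int j mod int CARD('a) ^ (i + j) = int j"
      by (intro mod_pos_pos_trivial; linarith)+
    with eq show "i = j"
      by simp
  qed
qed

instance fract :: ("{idom, ring_char_0}") ring_char_0
proof
  show "inj (of_nat :: nat \<Rightarrow> 'a fract)"
    by (rule injI) (simp add: of_nat_fract eq_fract)
qed

instance fract :: ("{idom, ring_char_0}") field_char_0 ..

type_synonym 'p padic = "'p padic_int fract"

definition padic_Ints :: "'p :: prime_card padic set" where
  "padic_Ints = range to_fract"

definition padic_cong :: "'p :: prime_card padic \<Rightarrow> 'p padic \<Rightarrow> nat \<Rightarrow> bool" where
  "padic_cong a b m \<longleftrightarrow> (a - b) / of_nat CARD('p) ^ m \<in> padic_Ints"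

definition padic_least_residue :: "'p :: prime_card padic \<Rightarrow> nat" where
  "padic_least_residue x = (LEAST r. padic_cong x (of_nat r) 1)"

definition dpoly :: "nat \<Rightarrow> 'a :: field_char_0 \<Rightarrow> 'a" where
  "dpoly n x = (\<Sum>k=0..n. of_nat (n choose k) * (x gchoose k) * 2 ^ k)"

end

theory Submission
  imports Defs
begin

text \<open>
  The forward differences \<open>D n x = d n (x + 1) - d n x\<close> satisfy \<open>D (n + 1) x = d n (x + 1) + d n x\<close>
  and \<open>(x + 1) D n x = n (d n x + d (n - 1) x)\<close>. This gives a three-term recurrence, the reflection
  \<open>d n (- 1 - x) = (- 1) ^ n d n x\<close>, and closed forms for all three sums over \<open>k < n\<close>: the
  alternating sum of squares at \<open>x\<close> plus that at \<open>x + 1\<close> is \<open>\<plusminus>(D n x)\<^sup>2 / 2\<close>, the plain sum is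
  \<open>n d n x d (n - 1) x / (2 x + 1)\<close>, and four times the weighted sum is
  \<open>(x + 1) (D n x)\<^sup>2 - x (D n (x - 1))\<^sup>2\<close>. For \<open>n = p\<close> the number \<open>D p x\<close> is divisible by \<open>p\<close>
  unless \<open>x \<equiv> - 1\<close> modulo \<open>p\<close>, in which case it is congruent to \<open>2\<close>. Hence everything reduces by
  steps of \<open>1\<close> to the case \<open>x \<equiv> 0\<close>, where \<open>d k x \<equiv> 1\<close> for \<open>k < p\<close> and
  \<open>d p x \<equiv> 1 + 2 x / p\<close> modulo \<open>p\<close>.
\<close>

subsection \<open>Identities for the polynomials\<close>

lemma dpoly_0 [simp]: "dpoly 0 x = 1"
  by (simp add: dpoly_def)

lemma dpoly_eq_sum_lessThan:
  "dpoly n x = 1 + (\<Sum>j<n. of_nat (n choose Suc j) * (x gchoose Suc j) * 2 ^ Suc j)"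
  by (simp add: dpoly_def atLeast0AtMost sum.atMost_shift)

lemma dpoly_0_right [simp]: "dpoly n 0 = 1"
  by (simp add: dpoly_eq_sum_lessThan)

lemma two_dpoly: "2 * dpoly n x = (\<Sum>j<Suc n. of_nat (n choose j) * (x gchoose j) * 2 ^ Suc j)"
  by (simp add: dpoly_def atLeast0AtMost lessThan_Suc_atMost sum_distrib_left mult_ac)

lemma sum_binomial_Suc_Suc:
  fixes f :: "nat \<Rightarrow> 'a :: comm_semiring_1"
  shows "(\<Sum>j<Suc n. of_nat (Suc n choose Suc j) * f j) =
    (\<Sum>j<Suc n. of_nat (n choose j) * f j) + (\<Sum>j<n. of_nat (n choose Suc j) * f j)"
proof -
  have "(\<Sum>j<n. of_nat (n choose Suc j) * f j) = (\<Sum>j<Suc n. of_nat (n choose Suc j) * f j)"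
    by (simp add: binomial_eq_0)
  then show ?thesis
    by (simp only: binomial_Suc_Suc of_nat_add distrib_right sum.distrib)
qed

lemma dpoly_Suc_diff:
  "dpoly (Suc n) x - dpoly n x = (\<Sum>j<Suc n. of_nat (n choose j) * (x gchoose Suc j) * 2 ^ Suc j)"
  using sum_binomial_Suc_Suc[of n "\<lambda>j. (x gchoose Suc j) * 2 ^ Suc j"]
  by (simp only: dpoly_eq_sum_lessThan mult.assoc) simp

definition dpoly_diff :: "nat \<Rightarrow> 'a :: field_char_0 \<Rightarrow> 'a" where
  "dpoly_diff n x = dpoly n (x + 1) - dpoly n x"

lemma dpoly_diff_0 [simp]: "dpoly_diff 0 x = 0"
  by (simp add: dpoly_diff_def)

lemma dpoly_diff_eq_sum:
  "dpoly_diff n x = (\<Sum>j<n. of_nat (n choose Suc j) * (x gchoose j) * 2 ^ Suc j)"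
  by (simp add: dpoly_diff_def dpoly_eq_sum_lessThan gbinomial_Suc_Suc ring_distribs sum.distrib)

lemma dpoly_diff_Suc: "dpoly_diff (Suc n) x = dpoly n (x + 1) + dpoly n x"
proof -
  have "dpoly_diff (Suc n) x = 2 * dpoly n x + dpoly_diff n x"
    using sum_binomial_Suc_Suc[of n "\<lambda>j. (x gchoose j) * 2 ^ Suc j"]
    by (simp only: dpoly_diff_eq_sum two_dpoly mult.assoc)
  then show ?thesis
    by (simp add: dpoly_diff_def)
qed

lemma dpoly_diff_absorption:
  "x * dpoly_diff n (x - 1) = of_nat n * (dpoly n x - dpoly (n - 1) x)"
proof (cases n)
  case (Suc m)
  have "x * (of_nat (Suc m choose Suc j) * (x - 1 gchoose j) * 2 ^ Suc j) =
      of_nat (Suc m) * (of_nat (m choose j) * (x gchoose Suc j) * 2 ^ Suc j)" for j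
  proof -
    have "x * (of_nat (Suc m choose Suc j) * (x - 1 gchoose j)) =
        of_nat (Suc m choose Suc j) * (of_nat (Suc j) * (x gchoose Suc j))"
      by (simp only: gbinomial_absorption mult.left_commute)
    also have "\<dots> = of_nat (Suc j * (Suc m choose Suc j)) * (x gchoose Suc j)"
      by (simp only: of_nat_mult mult_ac)
    also have "\<dots> = of_nat (Suc m) * (of_nat (m choose j) * (x gchoose Suc j))"
      unfolding Suc_times_binomial by (simp only: of_nat_mult mult.assoc)
    finally show ?thesis
      by (simp only: mult.assoc[symmetric])
  qed
  then show ?thesis
    by (simp only: Suc diff_Suc_1 dpoly_Suc_diff dpoly_diff_eq_sum sum_distrib_left)
qed simp

lemma dpoly_diff_absorption':
  "(x + 1) * dpoly_diff n x = of_nat n * (dpoly n x + dpoly (n - 1) x)"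
proof (cases n)
  case (Suc m)
  have "(x + 1) * dpoly_diff (Suc m) x = of_nat (Suc m) * (dpoly (Suc m) (x + 1) - dpoly m (x + 1))"
    using dpoly_diff_absorption[of "x + 1" "Suc m"] by simp
  also have "dpoly (Suc m) (x + 1) - dpoly m (x + 1) = dpoly (Suc m) x + dpoly m x"
    using dpoly_diff_Suc[of m x] by (simp add: dpoly_diff_def algebra_simps)
  finally show ?thesis
    by (simp add: Suc)
qed simp

lemma dpoly_recurrence:
  "of_nat (Suc n) * dpoly (Suc n) x = (2 * x + 1) * dpoly n x + of_nat n * dpoly (n - 1) x"
proof -
  have "of_nat (Suc n) * (dpoly (Suc n) x + dpoly n x) - of_nat n * (dpoly n x + dpoly (n - 1) x) =
      (x + 1) * (dpoly_diff (Suc n) x - dpoly_diff n x)"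
    using dpoly_diff_absorption'[of x n] dpoly_diff_absorption'[of x "Suc n"]
    by (simp add: right_diff_distrib)
  also have "dpoly_diff (Suc n) x - dpoly_diff n x = 2 * dpoly n x"
    by (simp add: dpoly_diff_Suc) (simp add: dpoly_diff_def)
  finally show ?thesis
    by (simp add: algebra_simps)
qed

lemma dpoly_reflect: "dpoly n (-1 - x) = (-1) ^ n * dpoly n x"
proof (induction n rule: induct_nat_012)
  case 1
  then show ?case
    using dpoly_recurrence[of 0 x] dpoly_recurrence[of 0 "-1 - x"] by simp
next
  case (ge2 n)
  let ?k = "Suc (Suc n)"
  have "of_nat ?k * dpoly ?k (-1 - x) = of_nat ?k * ((-1) ^ ?k * dpoly ?k x)"
    unfolding mult.left_commute[of "of_nat ?k"] dpoly_recurrence diff_Suc_1 ge2.IH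
    by (simp add: algebra_simps)
  then show ?case
    by (simp only: mult_cancel_left of_nat_eq_0_iff) simp
qed simp

lemma dpoly_minus_1 [simp]: "dpoly n (-1) = (-1) ^ n"
  using dpoly_reflect[of n 0] by simp

lemma dpoly_minus_half_odd: "odd n \<Longrightarrow> dpoly n (-1/2) = 0"
  using dpoly_reflect[of n "-1/2"] by simp

lemma sum_alternating_dpoly_square:
  "2 * ((\<Sum>k<n. (-1) ^ k * (dpoly k x)\<^sup>2) + (\<Sum>k<n. (-1) ^ k * (dpoly k (x + 1))\<^sup>2)) =
    - ((-1) ^ n * (dpoly_diff n x)\<^sup>2)"
proof (induction n)
  case (Suc n)
  then show ?case
    unfolding dpoly_diff_Suc by (simp add: dpoly_diff_def algebra_simps power2_eq_square)
qed simp

lemma sum_dpoly_square: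
  "(2 * x + 1) * (\<Sum>k<n. (dpoly k x)\<^sup>2) = of_nat n * dpoly n x * dpoly (n - 1) x"
proof (induction n)
  case (Suc n)
  then show ?case
    unfolding dpoly_recurrence by (simp add: algebra_simps power2_eq_square)
qed simp

lemma sum_odd_weighted_dpoly_square:
  "4 * (\<Sum>k<n. of_nat (2 * k + 1) * (dpoly k x)\<^sup>2) =
    (x + 1) * (dpoly_diff n x)\<^sup>2 - x * (dpoly_diff n (x - 1))\<^sup>2"
proof (induction n)
  case (Suc n)
  define S T u where "S = dpoly_diff n x" and "T = dpoly_diff n (x - 1)" and "u = dpoly n x"
  have diff_step: "dpoly_diff (Suc n) x = 2 * u + S" "dpoly_diff (Suc n) (x - 1) = 2 * u - T"
    by (simp_all add: dpoly_diff_Suc S_def T_def u_def) (simp_all add: dpoly_diff_def)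
  have absorption: "(x + 1) * S + x * T = of_nat (2 * n) * u"
    unfolding S_def T_def u_def dpoly_diff_absorption dpoly_diff_absorption'
    by (simp add: algebra_simps)
  have "(x + 1) * (2 * u + S)\<^sup>2 - x * (2 * u - T)\<^sup>2 =
      (x + 1) * S\<^sup>2 - x * T\<^sup>2 + 4 * u\<^sup>2 + 4 * u * ((x + 1) * S + x * T)"
    by (simp add: algebra_simps power2_eq_square)
  also have "\<dots> = (x + 1) * S\<^sup>2 - x * T\<^sup>2 + 4 * (of_nat (2 * n + 1) * u\<^sup>2)"
    unfolding absorption by (simp add: algebra_simps power2_eq_square)
  finally show ?case
    using Suc.IH by (simp add: diff_step distrib_left flip: S_def T_def u_def)
qed simp

subsection \<open>Congruences of p-adic numbers\<close>

lemma padic_int_eqI: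
  fixes a b :: "'p :: prime_card padic_int"
  assumes "\<And>n. padic_residue a n = padic_residue b n"
  shows "a = b"
  using assms by (metis ext padic_residue_inject)

lemma coherent_residues_imp_padic_int:
  fixes g :: "nat \<Rightarrow> int"
  assumes "\<And>n. [g (Suc n) = g n] (mod int CARD('p :: prime_card) ^ n)"
  obtains a :: "'p :: prime_card padic_int" where "\<And>n. padic_residue a n = g n mod int CARD('p) ^ n"
proof -
  have "padic_residue (Abs_padic_int (\<lambda>n. g n mod int CARD('p) ^ n) :: 'p padic_int) =
      (\<lambda>n. g n mod int CARD('p) ^ n)"
    using padic_closed[where 'p = 'p, of g] assms
    by (intro Abs_padic_int_inverse) (simp add: cong_def)
  then show thesis
    using that by metis
qed

lemma CARD_power_dvd_padic_int_iff:
  fixes a :: "'p :: prime_card padic_int"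
  shows "of_nat CARD('p) ^ n dvd a \<longleftrightarrow> padic_residue a n = 0"
proof
  assume "of_nat CARD('p) ^ n dvd a"
  then obtain b where "a = of_nat (CARD('p) ^ n) * b"
    unfolding of_nat_power by (elim dvdE)
  then show "padic_residue a n = 0"
    by (simp only: times_padic_int.rep_eq padic_residue_of_nat) simp
next
  assume residue_0: "padic_residue a n = 0"
  let ?P = "int CARD('p)"
  define g where "g k = padic_residue a (n + k) div ?P ^ n" for k
  have mult_g: "?P ^ n * g k = padic_residue a (n + k)" for k
    using padic_residue_add_mod[of a n k] residue_0 by (simp add: g_def dvd_eq_mod_eq_0)
  have "[g (Suc k) = g k] (mod ?P ^ k)" for k
  proof -
    have "[?P ^ n * g (Suc k) = ?P ^ n * g k] (mod ?P ^ (n + k))"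
      unfolding mult_g by (simp add: cong_def padic_residue_mod padic_residue_Suc_mod)
    then show ?thesis
      by (simp add: cong_iff_dvd_diff power_add flip: right_diff_distrib)
  qed
  then obtain b :: "'p padic_int" where residue_b: "\<And>k. padic_residue b k = g k mod ?P ^ k"
    by (rule coherent_residues_imp_padic_int) auto
  have "a = of_nat (CARD('p) ^ n) * b"
  proof (rule padic_int_eqI)
    fix k
    have "padic_residue (of_nat (CARD('p) ^ n) * b) k = ?P ^ n * g k mod ?P ^ k"
      by (simp only: times_padic_int.rep_eq padic_residue_of_nat residue_b mod_simps) simp
    then show "padic_residue a k = padic_residue (of_nat (CARD('p) ^ n) * b) k"
      using padic_residue_add_mod[of a k n] by (simp add: mult_g add.commute)
  qed
  then show "of_nat CARD('p) ^ n dvd a"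
    by simp
qed

lemma coprime_padic_residue:
  fixes a :: "'p :: prime_card padic_int"
  assumes "padic_residue a 1 \<noteq> 0"
  shows "coprime (padic_residue a n) (int CARD('p) ^ n)"
proof (cases n)
  case (Suc m)
  have "\<not> int CARD('p) dvd padic_residue a n"
    using padic_residue_add_mod[of a 1 m] assms Suc by (simp add: dvd_eq_mod_eq_0)
  then show ?thesis
    using prime_imp_coprime[OF prime_card_int[where 'a = 'p]] by (simp add: coprime_commute)
qed simp

lemma padic_int_unit_iff:
  fixes a :: "'p :: prime_card padic_int"
  shows "a dvd 1 \<longleftrightarrow> padic_residue a 1 \<noteq> 0"
proof
  assume "a dvd 1"
  show "padic_residue a 1 \<noteq> 0"
  proof
    assume "padic_residue a 1 = 0"
    then have "of_nat CARD('p) ^ 1 dvd (1 :: 'p padic_int)"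
      using \<open>a dvd 1\<close> unfolding CARD_power_dvd_padic_int_iff[symmetric] by (rule dvd_trans)
    then have "padic_residue (1 :: 'p padic_int) 1 = 0"
      unfolding CARD_power_dvd_padic_int_iff .
    then show False
      using prime_gt_1_int[OF prime_card_int[where 'a = 'p]] by (simp add: one_padic_int.rep_eq)
  qed
next
  let ?P = "int CARD('p)"
  assume "padic_residue a 1 \<noteq> 0"
  then have coprime: "coprime (padic_residue a n) (?P ^ n)" for n
    by (rule coprime_padic_residue)
  then have "\<forall>n. \<exists>h. [padic_residue a n * h = 1] (mod ?P ^ n)"
    using cong_solve_coprime_int by blast
  then obtain h where inverse: "\<And>n. [padic_residue a n * h n = 1] (mod ?P ^ n)"
    by metis
  have "[h (Suc n) = h n] (mod ?P ^ n)" for n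
  proof -
    have "[padic_residue a (Suc n) * h (Suc n) = 1] (mod ?P ^ n)"
      using inverse[of "Suc n"] by (rule cong_dvd_modulus) simp
    moreover have "[padic_residue a (Suc n) = padic_residue a n] (mod ?P ^ n)"
      by (simp add: cong_def padic_residue_Suc_mod padic_residue_mod)
    ultimately have "[padic_residue a n * h (Suc n) = padic_residue a n * h n] (mod ?P ^ n)"
      using inverse[of n] by (metis cong_scalar_right cong_sym cong_trans)
    then show ?thesis
      by (simp only: cong_mult_lcancel[OF coprime])
  qed
  then obtain b :: "'p padic_int" where residue_b: "\<And>n. padic_residue b n = h n mod ?P ^ n"
    by (rule coherent_residues_imp_padic_int) auto
  have "1 = a * b"
  proof (rule padic_int_eqI)
    fix n
    show "padic_residue (1 :: 'p padic_int) n = padic_residue (a * b) n"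
      using inverse[of n]
      by (simp add: times_padic_int.rep_eq one_padic_int.rep_eq residue_b mod_simps cong_def)
  qed
  then show "a dvd 1" ..
qed

lemma to_fract_of_nat [simp]: "to_fract (of_nat k) = of_nat k"
  by (induction k) simp_all

lemma padic_Ints_closed [simp, intro]:
  fixes a b :: "'p :: prime_card padic"
  shows padic_Ints_0: "0 \<in> (padic_Ints :: 'p padic set)"
    and padic_Ints_1: "1 \<in> (padic_Ints :: 'p padic set)"
    and padic_Ints_of_nat: "of_nat k \<in> (padic_Ints :: 'p padic set)"
    and padic_Ints_numeral: "numeral w \<in> (padic_Ints :: 'p padic set)"
    and padic_Ints_minus: "a \<in> padic_Ints \<Longrightarrow> - a \<in> padic_Ints"
    and padic_Ints_add: "a \<in> padic_Ints \<Longrightarrow> b \<in> padic_Ints \<Longrightarrow> a + b \<in> padic_Ints"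
    and padic_Ints_diff: "a \<in> padic_Ints \<Longrightarrow> b \<in> padic_Ints \<Longrightarrow> a - b \<in> padic_Ints"
    and padic_Ints_mult: "a \<in> padic_Ints \<Longrightarrow> b \<in> padic_Ints \<Longrightarrow> a * b \<in> padic_Ints"
proof -
  show of_nat: "of_nat k \<in> (padic_Ints :: 'p padic set)" for k
    unfolding padic_Ints_def by (metis rangeI to_fract_of_nat)
  show "0 \<in> (padic_Ints :: 'p padic set)" "1 \<in> (padic_Ints :: 'p padic set)"
    "numeral w \<in> (padic_Ints :: 'p padic set)"
    using of_nat[of 0] of_nat[of 1] of_nat[of "numeral w"] by simp_all
qed (auto simp: padic_Ints_def simp flip: to_fract_uminus to_fract_add to_fract_diff to_fract_mult)

lemma padic_Ints_power [simp, intro]: "a \<in> padic_Ints \<Longrightarrow> a ^ n \<in> padic_Ints"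
  by (induction n) auto

lemma padic_Ints_sum: "(\<And>k. k \<in> A \<Longrightarrow> f k \<in> padic_Ints) \<Longrightarrow> sum f A \<in> padic_Ints"
  by (induction A rule: infinite_finite_induct) auto

lemma padic_Ints_prod: "(\<And>k. k \<in> A \<Longrightarrow> f k \<in> padic_Ints) \<Longrightarrow> prod f A \<in> padic_Ints"
  by (induction A rule: infinite_finite_induct) auto

lemma padic_cong_iff:
  fixes a b :: "'p :: prime_card padic"
  shows "padic_cong a b m \<longleftrightarrow> (\<exists>z\<in>padic_Ints. a = b + of_nat CARD('p) ^ m * z)"
proof
  assume "padic_cong a b m"
  then show "\<exists>z\<in>padic_Ints. a = b + of_nat CARD('p) ^ m * z"
    unfolding padic_cong_def by (intro bexI[of _ "(a - b) / of_nat CARD('p) ^ m"]) simp_all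
qed (auto simp: padic_cong_def)

lemma padic_cong_to_fract_iff:
  fixes a b :: "'p :: prime_card padic_int"
  shows "padic_cong (to_fract a) (to_fract b) m \<longleftrightarrow> padic_residue a m = padic_residue b m"
proof -
  have "to_fract b + of_nat CARD('p) ^ m * to_fract c = to_fract (b + of_nat CARD('p) ^ m * c)" for c
    by (simp flip: of_nat_power)
  then have "to_fract a = to_fract b + of_nat CARD('p) ^ m * to_fract c \<longleftrightarrow>
      a - b = of_nat CARD('p) ^ m * c" for c
    by (simp only: to_fract_eq_iff diff_eq_eq add.commute)
  then have "padic_cong (to_fract a) (to_fract b) m \<longleftrightarrow> of_nat CARD('p) ^ m dvd a - b"
    by (auto simp: padic_cong_iff padic_Ints_def dvd_def)
  also have "\<dots> \<longleftrightarrow> padic_residue (a - b) m = 0"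
    by (rule CARD_power_dvd_padic_int_iff)
  also have "\<dots> \<longleftrightarrow> padic_residue a m mod int CARD('p) ^ m = padic_residue b m mod int CARD('p) ^ m"
    by (simp only: minus_padic_int.rep_eq mod_eq_dvd_iff dvd_eq_mod_eq_0)
  finally show ?thesis
    by (simp only: padic_residue_mod)
qed

lemma padic_cong_of_nat_iff:
  "padic_cong (of_nat i :: 'p :: prime_card padic) (of_nat j) m \<longleftrightarrow> [i = j] (mod CARD('p) ^ m)"
  unfolding to_fract_of_nat[symmetric] padic_cong_to_fract_iff padic_residue_of_nat
  by (simp add: cong_def flip: of_nat_power zmod_int)

lemma padic_cong_of_nat_0_iff:
  "padic_cong (of_nat k :: 'p :: prime_card padic) 0 1 \<longleftrightarrow> CARD('p) dvd k"
  using padic_cong_of_nat_iff[where 'p = 'p, of k 0 1] by (simp add: cong_0_iff)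

lemma padic_of_nat_not_cong_0:
  "0 < k \<Longrightarrow> k < CARD('p) \<Longrightarrow> \<not> padic_cong (of_nat k :: 'p :: prime_card padic) 0 1"
  unfolding padic_cong_of_nat_0_iff using nat_dvd_not_less by blast

lemma padic_fact_not_cong_0:
  "k < CARD('p) \<Longrightarrow> \<not> padic_cong (fact k :: 'p :: prime_card padic) 0 1"
  using padic_cong_of_nat_0_iff[where 'p = 'p, of "fact k"]
  by (simp add: prime_dvd_fact_iff prime_card)

lemma padic_2_not_cong_0:
  "odd CARD('p) \<Longrightarrow> \<not> padic_cong (2 :: 'p :: prime_card padic) 0 1"
  using padic_cong_of_nat_0_iff[where 'p = 'p, of 2] prime_card[where 'a = 'p]
  by (metis of_nat_numeral primes_dvd_imp_eq two_is_prime_nat even_numeral)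

lemma ex_padic_residue:
  fixes x :: "'p :: prime_card padic"
  assumes "x \<in> padic_Ints"
  obtains r where "r < CARD('p) ^ m" "padic_cong x (of_nat r) m"
proof -
  obtain a where x_eq: "x = to_fract a"
    using assms by (auto simp: padic_Ints_def)
  define r where "r = nat (padic_residue a m)"
  have "padic_residue a m \<in> {0..<int CARD('p) ^ m}"
    using padic_residue[of a] by blast
  then have int_r: "int r = padic_residue a m" and r_less: "int r < int (CARD('p) ^ m)"
    by (auto simp: r_def)
  have "padic_cong (to_fract a) (to_fract (of_nat r)) m"
    unfolding padic_cong_to_fract_iff padic_residue_of_nat int_r padic_residue_mod ..
  with r_less show thesis
    by (intro that) (simp_all only: x_eq to_fract_of_nat of_nat_less_iff)
qed

lemma padic_cong_refl [simp]: "padic_cong a a m"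
  by (simp add: padic_cong_def)

lemma padic_cong_diff_0_iff: "padic_cong (a - b) 0 m \<longleftrightarrow> padic_cong a b m"
  by (simp add: padic_cong_def)

lemma padic_cong_minus_1_iff: "padic_cong a (-1) m \<longleftrightarrow> padic_cong (a + 1) 0 m"
  by (simp add: padic_cong_def)

lemma padic_cong_sym: "padic_cong a b m \<Longrightarrow> padic_cong b a m"
  using padic_Ints_minus unfolding padic_cong_def
  by (metis minus_diff_eq minus_divide_left)

lemma padic_cong_add:
  "padic_cong a b m \<Longrightarrow> padic_cong c d m \<Longrightarrow> padic_cong (a + c) (b + d) m"
  unfolding padic_cong_def add_diff_add add_divide_distrib by (rule padic_Ints_add)

lemma padic_cong_trans [trans]:
  "padic_cong a b m \<Longrightarrow> padic_cong b c m \<Longrightarrow> padic_cong a c m"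
  using padic_cong_add[of a b m b c] by (simp add: padic_cong_def)

lemma padic_cong_mult_0:
  "padic_cong a 0 m \<Longrightarrow> padic_cong b 0 n \<Longrightarrow> padic_cong (a * b) 0 (m + n)"
  using padic_Ints_mult[of "a / of_nat CARD(_) ^ m" "b / of_nat CARD(_) ^ n"]
  by (simp add: padic_cong_def power_add)

lemma padic_cong_0_scalar_left:
  assumes "padic_cong c 0 m" "padic_cong a b n"
  shows "padic_cong (c * a) (c * b) (m + n)"
  using padic_cong_mult_0[OF assms(1), of "a - b" n] assms(2)
  by (simp add: right_diff_distrib padic_cong_diff_0_iff)

lemma padic_cong_scalar_left:
  "c \<in> padic_Ints \<Longrightarrow> padic_cong a b m \<Longrightarrow> padic_cong (c * a) (c * b) m"
  using padic_cong_0_scalar_left[of c 0] by (simp add: padic_cong_def)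

lemma padic_cong_minus: "padic_cong a b m \<Longrightarrow> padic_cong (- a) (- b) m"
  using padic_cong_scalar_left[of "-1" a b m] by simp

lemma padic_cong_diff:
  "padic_cong a b m \<Longrightarrow> padic_cong c d m \<Longrightarrow> padic_cong (a - c) (b - d) m"
  using padic_cong_add[OF _ padic_cong_minus, of a b m c d] by simp

lemma padic_cong_mult:
  assumes "padic_cong a b m" "padic_cong c d m" "a \<in> padic_Ints" "d \<in> padic_Ints"
  shows "padic_cong (a * c) (b * d) m"
  using padic_cong_scalar_left[OF assms(3,2)] padic_cong_scalar_left[OF assms(4,1)]
  by (auto intro: padic_cong_trans simp: mult.commute)

lemma padic_cong_power2:
  assumes "padic_cong a b m" "a \<in> padic_Ints" "b \<in> padic_Ints"
  shows "padic_cong (a\<^sup>2) (b\<^sup>2) m"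
  unfolding power2_eq_square using assms by (intro padic_cong_mult)

lemma padic_cong_power2_0: "padic_cong a 0 1 \<Longrightarrow> padic_cong (a\<^sup>2) 0 2"
  using padic_cong_mult_0[of a 1 a 1] by (simp only: power2_eq_square one_add_one)

lemma padic_cong_sum:
  "(\<And>k. k \<in> A \<Longrightarrow> padic_cong (f k) (g k) m) \<Longrightarrow> padic_cong (sum f A) (sum g A) m"
  by (induction A rule: infinite_finite_induct) (auto intro: padic_cong_add)

lemma padic_cong_prod:
  assumes "\<And>k. k \<in> A \<Longrightarrow> padic_cong (f k) (g k) m"
    and "\<And>k. k \<in> A \<Longrightarrow> f k \<in> padic_Ints" "\<And>k. k \<in> A \<Longrightarrow> g k \<in> padic_Ints"
  shows "padic_cong (prod f A) (prod g A) m"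
  using assms
  by (induction A rule: infinite_finite_induct) (auto intro!: padic_cong_mult padic_Ints_prod)

lemma padic_cong_imp_Ints: "padic_cong a b m \<Longrightarrow> b \<in> padic_Ints \<Longrightarrow> a \<in> padic_Ints"
  by (auto simp: padic_cong_iff)

lemma padic_inverse_Ints:
  fixes a :: "'p :: prime_card padic"
  assumes "a \<in> padic_Ints" "\<not> padic_cong a 0 1"
  shows "inverse a \<in> padic_Ints"
proof -
  obtain b where a_eq: "a = to_fract b"
    using assms(1) by (auto simp: padic_Ints_def)
  then have "padic_residue b 1 \<noteq> 0"
    using assms(2) padic_cong_to_fract_iff[of b 0 1] by (simp add: zero_padic_int.rep_eq)
  then obtain c where "1 = b * c"
    using padic_int_unit_iff by (metis dvdE)
  then have "a * to_fract c = 1"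
    unfolding a_eq by (metis to_fract_1 to_fract_mult)
  then have "inverse a = to_fract c"
    by (rule inverse_unique)
  then show ?thesis
    by (simp add: padic_Ints_def)
qed

lemma padic_cong_mult_lcancel:
  assumes "padic_cong (c * a) (c * b) m" "c \<in> padic_Ints" "\<not> padic_cong c 0 1"
  shows "padic_cong a b m"
proof -
  have "c \<noteq> 0"
    using assms(3) by auto
  then show ?thesis
    using padic_cong_scalar_left[OF padic_inverse_Ints[OF assms(2,3)] assms(1)]
    by (simp flip: mult.assoc)
qed

subsection \<open>Least residues\<close>

lemma padic_least_residue:
  fixes x :: "'p :: prime_card padic"
  assumes "x \<in> padic_Ints"
  shows padic_cong_least_residue: "padic_cong x (of_nat (padic_least_residue x)) 1"
    and padic_least_residue_less: "padic_least_residue x < CARD('p)"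
proof -
  obtain r where "r < CARD('p)" "padic_cong x (of_nat r) 1"
    using ex_padic_residue[OF assms, of 1] by auto
  then show "padic_cong x (of_nat (padic_least_residue x)) 1" "padic_least_residue x < CARD('p)"
    unfolding padic_least_residue_def by (auto intro: LeastI Least_le[THEN le_less_trans])
qed

lemma padic_least_residue_unique:
  fixes x :: "'p :: prime_card padic"
  assumes "padic_cong x (of_nat r) 1" "r < CARD('p)"
  shows "padic_least_residue x = r"
proof -
  have x_Ints: "x \<in> padic_Ints"
    using assms(1) by (rule padic_cong_imp_Ints) simp
  have "padic_cong (of_nat (padic_least_residue x) :: 'p padic) (of_nat r) 1"
    using padic_cong_sym[OF padic_cong_least_residue[OF x_Ints]] assms(1) by (rule padic_cong_trans)
  then show ?thesis
    using padic_least_residue_less[OF x_Ints] assms(2)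
    by (simp add: padic_cong_of_nat_iff cong_less_modulus_unique_nat)
qed

lemma padic_least_residue_cong_0:
  "padic_cong x 0 1 \<Longrightarrow> padic_least_residue x = 0"
  by (rule padic_least_residue_unique) simp_all

lemma padic_least_residue_plus_1:
  fixes x :: "'p :: prime_card padic"
  assumes "x \<in> padic_Ints" "\<not> padic_cong x (-1) 1"
  shows "padic_least_residue (x + 1) = Suc (padic_least_residue x)"
proof -
  let ?r = "padic_least_residue x"
  have cong: "padic_cong (x + 1) (of_nat (Suc ?r)) 1"
    using padic_cong_add[OF padic_cong_least_residue[OF assms(1)] padic_cong_refl[of 1]]
    by (simp add: add.commute)
  have "Suc ?r \<noteq> CARD('p)"
  proof
    assume "Suc ?r = CARD('p)"
    then have "padic_cong (of_nat (Suc ?r) :: 'p padic) 0 1"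
      unfolding padic_cong_of_nat_0_iff by simp
    with cong have "padic_cong (x + 1) 0 1"
      by (rule padic_cong_trans)
    with assms(2) show False
      by (simp add: padic_cong_minus_1_iff)
  qed
  then show ?thesis
    using cong padic_least_residue_less[OF assms(1)] by (intro padic_least_residue_unique) simp_all
qed

lemma padic_Ints_residue_induct [consumes 1, case_names cong_0 plus_1]:
  fixes x :: "'p :: prime_card padic"
  assumes "x \<in> padic_Ints"
    and cong_0: "\<And>y. padic_cong y 0 1 \<Longrightarrow> P y"
    and plus_1: "\<And>y. y \<in> padic_Ints \<Longrightarrow> \<not> padic_cong y (-1) 1 \<Longrightarrow> P y \<Longrightarrow> P (y + 1)"
  shows "P x"
proof -
  have "P y" if "padic_cong y (of_nat r) 1" "r < CARD('p)" for y r
    using that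
  proof (induction r arbitrary: y)
    case 0
    then show ?case
      by (simp add: cong_0)
  next
    case (Suc r)
    have cong: "padic_cong (y - 1) (of_nat r) 1"
      using padic_cong_diff[OF Suc.prems(1) padic_cong_refl[of 1]] by simp
    have "\<not> padic_cong y 0 1"
      using Suc.prems padic_of_nat_not_cong_0[where 'p = 'p, of "Suc r"]
      by (blast intro: padic_cong_trans padic_cong_sym)
    then have "P (y - 1 + 1)"
      using cong Suc by (intro plus_1 padic_cong_imp_Ints[OF cong]) (simp_all add: padic_cong_minus_1_iff)
    then show ?case
      by simp
  qed
  then show ?thesis
    using padic_least_residue[OF assms(1)] by blast
qed

definition padic_quotient :: "'p :: prime_card padic \<Rightarrow> 'p padic" where
  "padic_quotient x = (x - of_nat (padic_least_residue x)) / of_nat CARD('p)"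

lemma padic_quotient_Ints: "x \<in> padic_Ints \<Longrightarrow> padic_quotient x \<in> padic_Ints"
  using padic_cong_least_residue[of x] by (simp add: padic_cong_def padic_quotient_def)

lemma CARD_mult_padic_quotient:
  fixes x :: "'p :: prime_card padic"
  shows "of_nat CARD('p) * padic_quotient x = x - of_nat (padic_least_residue x)"
  by (simp add: padic_quotient_def)

lemma padic_quotient_plus_1:
  "x \<in> padic_Ints \<Longrightarrow> \<not> padic_cong x (-1) 1 \<Longrightarrow> padic_quotient (x + 1) = padic_quotient x"
  by (simp add: padic_quotient_def padic_least_residue_plus_1)

subsection \<open>Values at p-adic integers\<close>

text \<open>Write \<open>k! = p ^ m * u\<close> with \<open>u\<close> prime to \<open>p\<close> and take a natural number congruent to \<open>x\<close>
  modulo \<open>p ^ m\<close>, whose binomial coefficient is an integer.\<close>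

lemma gbinomial_padic_Ints:
  fixes x :: "'p :: prime_card padic"
  assumes "x \<in> padic_Ints"
  shows "x gchoose k \<in> padic_Ints"
proof -
  have "\<not> is_unit CARD('p)"
    using prime_card[where 'a = 'p] by (metis not_prime_unit)
  then obtain m u where fact_eq: "fact k = CARD('p) ^ m * u" and not_dvd_u: "\<not> CARD('p) dvd u"
    using multiplicity_decompose'[of "fact k :: nat" "CARD('p)"] fact_nonzero by metis
  obtain n where x_cong: "padic_cong x (of_nat n) m"
    using ex_padic_residue[OF assms] by metis
  have "padic_cong (fact k * (x gchoose k)) (fact k * (of_nat n gchoose k)) m"
    unfolding gbinomial_mult_fact using assms x_cong
    by (intro padic_cong_prod padic_cong_diff padic_cong_refl padic_Ints_closed)
  moreover have "(fact k :: 'p padic) = of_nat CARD('p) ^ m * of_nat u"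
    using arg_cong[OF fact_eq, of "of_nat :: nat \<Rightarrow> 'p padic"] by simp
  ultimately have "padic_cong (of_nat u * (x gchoose k)) (of_nat u * of_nat (n choose k)) 0"
    by (simp add: padic_cong_def binomial_gbinomial mult.assoc flip: right_diff_distrib)
  then have "padic_cong (x gchoose k) (of_nat (n choose k)) 0"
    by (rule padic_cong_mult_lcancel)
      (simp_all only: padic_Ints_of_nat padic_cong_of_nat_0_iff not_dvd_u not_False_eq_True)
  then show ?thesis
    by (rule padic_cong_imp_Ints) simp
qed

lemma gbinomial_padic_cong:
  fixes x y :: "'p :: prime_card padic"
  assumes "padic_cong x y m" "x \<in> padic_Ints" "y \<in> padic_Ints" "k < CARD('p)"
  shows "padic_cong (x gchoose k) (y gchoose k) m"
proof (rule padic_cong_mult_lcancel)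
  show "padic_cong (fact k * (x gchoose k)) (fact k * (y gchoose k)) m"
    unfolding gbinomial_mult_fact using assms
    by (intro padic_cong_prod padic_cong_diff padic_cong_refl padic_Ints_closed)
  show "(fact k :: 'p padic) \<in> padic_Ints"
    using padic_Ints_of_nat[of "fact k"] by simp
  show "\<not> padic_cong (fact k :: 'p padic) 0 1"
    using assms(4) by (rule padic_fact_not_cong_0)
qed

lemma dpoly_padic_Ints [simp, intro]: "x \<in> padic_Ints \<Longrightarrow> dpoly k x \<in> padic_Ints"
  unfolding dpoly_def by (intro padic_Ints_sum padic_Ints_closed padic_Ints_power gbinomial_padic_Ints)

lemma dpoly_padic_cong:
  fixes x y :: "'p :: prime_card padic"
  assumes "padic_cong x y m" "x \<in> padic_Ints" "y \<in> padic_Ints" "k < CARD('p)"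
  shows "padic_cong (dpoly k x) (dpoly k y) m"
  unfolding dpoly_def using assms
  by (intro padic_cong_sum padic_cong_mult padic_cong_refl gbinomial_padic_cong gbinomial_padic_Ints
      padic_Ints_closed padic_Ints_power) auto

lemma dpoly_padic_cong_1:
  fixes x :: "'p :: prime_card padic"
  assumes "padic_cong x 0 m" "k < CARD('p)"
  shows "padic_cong (dpoly k x) 1 m"
  using dpoly_padic_cong[OF assms(1) padic_cong_imp_Ints[OF assms(1)]] assms(2) by simp

lemma dpoly_diff_CARD:
  "dpoly_diff CARD('p :: prime_card) x = dpoly (CARD('p) - 1) (x + 1) + dpoly (CARD('p) - 1) x"
  using dpoly_diff_Suc[of "CARD('p) - 1" x] by simp

lemma dpoly_diff_CARD_cong_0:
  fixes x :: "'p :: prime_card padic"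
  assumes "x \<in> padic_Ints" "\<not> padic_cong x (-1) 1"
  shows "padic_cong (dpoly_diff CARD('p) x) 0 1"
proof (rule padic_cong_mult_lcancel)
  show "padic_cong ((x + 1) * dpoly_diff CARD('p) x) ((x + 1) * 0) 1"
    unfolding dpoly_diff_absorption' using assms(1) by (simp add: padic_cong_def)
qed (use assms in \<open>simp_all add: padic_cong_minus_1_iff\<close>)

lemma dpoly_diff_CARD_cong_2:
  fixes x :: "'p :: prime_card padic"
  assumes "odd CARD('p)" "padic_cong x (-1) 1"
  shows "padic_cong (dpoly_diff CARD('p) x) 2 1"
proof -
  let ?q = "CARD('p) - 1"
  have "x \<in> padic_Ints"
    using assms(2) by (rule padic_cong_imp_Ints) simp
  then have "padic_cong (dpoly ?q (x + 1) + dpoly ?q x) (1 + dpoly ?q (-1)) 1"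
    using assms(2)
    by (intro padic_cong_add dpoly_padic_cong_1 dpoly_padic_cong)
      (simp_all add: padic_cong_minus_1_iff)
  then show ?thesis
    using assms(1) by (simp add: dpoly_diff_CARD)
qed

lemma dpoly_CARD_minus_1_cong:
  fixes x :: "'p :: prime_card padic"
  assumes "x \<in> padic_Ints"
  shows "padic_cong (dpoly (CARD('p) - 1) x) ((-1) ^ padic_least_residue x) 1"
  using assms
proof (induction rule: padic_Ints_residue_induct)
  case (cong_0 y)
  then show ?case
    using dpoly_padic_cong_1[of y 1 "CARD('p) - 1"] by (simp add: padic_least_residue_cong_0)
next
  case (plus_1 y)
  have "padic_cong (dpoly (CARD('p) - 1) (y + 1) + dpoly (CARD('p) - 1) y) 0 1"
    using dpoly_diff_CARD_cong_0[OF plus_1.hyps] unfolding dpoly_diff_CARD .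
  from padic_cong_diff[OF this plus_1.IH] show ?case
    using plus_1.hyps by (simp add: padic_least_residue_plus_1)
qed

lemma dpoly_CARD_cong:
  fixes x :: "'p :: prime_card padic"
  assumes "odd CARD('p)" "x \<in> padic_Ints"
  shows "padic_cong (dpoly CARD('p) x) (1 + 2 * padic_quotient x) 1"
  using assms(2)
proof (induction rule: padic_Ints_residue_induct)
  case (cong_0 y)
  have y_Ints: "y \<in> padic_Ints" and y_eq: "y = of_nat CARD('p) * padic_quotient y"
    using padic_cong_imp_Ints[OF cong_0] padic_least_residue_cong_0[OF cong_0]
    by (simp_all add: CARD_mult_padic_quotient)
  have "of_nat CARD('p) * (dpoly CARD('p) y - dpoly (CARD('p) - 1) y) =
      of_nat CARD('p) * (padic_quotient y * dpoly_diff CARD('p) (y - 1))"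
    unfolding dpoly_diff_absorption[symmetric] mult.assoc[symmetric] y_eq[symmetric] ..
  then have "dpoly CARD('p) y = dpoly (CARD('p) - 1) y + padic_quotient y * dpoly_diff CARD('p) (y - 1)"
    by (simp add: diff_eq_eq)
  also have "padic_cong \<dots> (1 + padic_quotient y * 2) 1"
    using assms(1) cong_0 y_Ints
    by (intro padic_cong_add padic_cong_scalar_left dpoly_padic_cong_1 padic_quotient_Ints
        dpoly_diff_CARD_cong_2) (simp_all add: padic_cong_minus_1_iff)
  finally show ?case
    by (simp add: mult.commute)
next
  case (plus_1 y)
  have "padic_cong (dpoly CARD('p) (y + 1) - dpoly CARD('p) y) 0 1"
    using dpoly_diff_CARD_cong_0[OF plus_1.hyps] unfolding dpoly_diff_def .
  from padic_cong_add[OF this plus_1.IH] show ?case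
    using plus_1.hyps by (simp add: padic_quotient_plus_1)
qed

subsection \<open>The alternating sum of squares\<close>

lemma dpoly_even_padic_cong:
  fixes x :: "'p :: prime_card padic"
  assumes "padic_cong x 0 1" "even n" "0 < n" "n < CARD('p)"
  shows "padic_cong (dpoly n x) (dpoly (n - 1) x) 2"
proof -
  have x_Ints: "x \<in> padic_Ints"
    using assms(1) by (rule padic_cong_imp_Ints) simp
  have "padic_cong (dpoly n x - dpoly n (x - 1)) (1 - dpoly n (-1)) 1"
    using assms x_Ints
    by (intro padic_cong_diff dpoly_padic_cong_1 dpoly_padic_cong)
      (simp_all add: padic_cong_minus_1_iff)
  then have "padic_cong (dpoly_diff n (x - 1)) 0 1"
    using assms(2) by (simp add: dpoly_diff_def)
  with assms(1) have "padic_cong (x * dpoly_diff n (x - 1)) 0 (1 + 1)"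
    by (rule padic_cong_mult_0)
  then have "padic_cong (of_nat n * (dpoly n x - dpoly (n - 1) x)) (of_nat n * 0) 2"
    unfolding dpoly_diff_absorption one_add_one by simp
  then have "padic_cong (dpoly n x - dpoly (n - 1) x) 0 2"
    by (rule padic_cong_mult_lcancel[OF _ padic_Ints_of_nat padic_of_nat_not_cong_0[OF assms(3,4)]])
  then show ?thesis
    by (simp only: padic_cong_diff_0_iff)
qed

lemma sum_alternating_dpoly_square_cong_1:
  fixes x :: "'p :: prime_card padic"
  assumes "padic_cong x 0 1" "2 * m < CARD('p)"
  shows "padic_cong (\<Sum>k<Suc (2 * m). (-1) ^ k * (dpoly k x)\<^sup>2) 1 2"
  using assms(2)
proof (induction m)
  case (Suc m)
  have "padic_cong (dpoly (2 * m + 2) x) (dpoly (2 * m + 1) x) 2"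
    using dpoly_even_padic_cong[OF assms(1), of "2 * m + 2"] Suc.prems by simp
  then have "padic_cong ((dpoly (2 * m + 2) x)\<^sup>2) ((dpoly (2 * m + 1) x)\<^sup>2) 2"
    using padic_cong_imp_Ints[OF assms(1)] by (intro padic_cong_power2 dpoly_padic_Ints) simp_all
  then have "padic_cong ((dpoly (2 * m + 2) x)\<^sup>2 - (dpoly (2 * m + 1) x)\<^sup>2) 0 2"
    by (simp only: padic_cong_diff_0_iff)
  from padic_cong_add[OF Suc.IH this] show ?case
    using Suc.prems by (simp add: algebra_simps)
qed simp

lemma sum_alternating_dpoly_square_cong:
  fixes x :: "'p :: prime_card padic"
  assumes "odd CARD('p)" "x \<in> padic_Ints"
  shows "padic_cong (\<Sum>k<CARD('p). (-1) ^ k * (dpoly k x)\<^sup>2) ((-1) ^ padic_least_residue x) 2"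
  using assms(2)
proof (induction rule: padic_Ints_residue_induct)
  case (cong_0 y)
  obtain m where "CARD('p) = 2 * m + 1"
    using assms(1) by (rule oddE)
  then show ?case
    using sum_alternating_dpoly_square_cong_1[OF cong_0, of m] cong_0
    by (simp add: padic_least_residue_cong_0)
next
  case (plus_1 y)
  let ?F = "\<lambda>y. \<Sum>k<CARD('p). (-1) ^ k * (dpoly k y)\<^sup>2"
  have "padic_cong (2 * (?F y + ?F (y + 1))) (2 * 0) 2"
    unfolding sum_alternating_dpoly_square
    using padic_cong_power2_0[OF dpoly_diff_CARD_cong_0[OF plus_1.hyps]] assms(1) by simp
  then have "padic_cong (?F y + ?F (y + 1)) 0 2"
    by (rule padic_cong_mult_lcancel[OF _ padic_Ints_numeral padic_2_not_cong_0[OF assms(1)]])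
  from padic_cong_diff[OF this plus_1.IH] show ?case
    using plus_1.hyps by (simp add: padic_least_residue_plus_1)
qed

subsection \<open>The sum of squares\<close>

lemma padic_cong_minus_half_iff:
  fixes x :: "'p :: prime_card padic"
  assumes "odd CARD('p)"
  shows "padic_cong x (-1/2) 1 \<longleftrightarrow> padic_cong (2 * x + 1) 0 1"
proof -
  have "padic_cong (2 * x + 1) 0 1 \<longleftrightarrow> padic_cong (2 * x) (2 * (-1/2)) 1"
    by (simp add: padic_cong_def)
  also have "\<dots> \<longleftrightarrow> padic_cong x (-1/2) 1"
    using padic_cong_mult_lcancel[of 2 x "-1/2"] padic_cong_scalar_left[of 2 x "-1/2"]
      padic_2_not_cong_0[OF assms] by auto
  finally show ?thesis ..
qed

lemma half_padic_Ints:
  assumes "odd CARD('p)"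
  shows "1/2 \<in> (padic_Ints :: 'p :: prime_card padic set)"
  using padic_inverse_Ints[OF _ padic_2_not_cong_0[OF assms]] by (simp add: inverse_eq_divide)

lemma padic_least_residue_minus_half:
  fixes x :: "'p :: prime_card padic"
  assumes "odd CARD('p)" "padic_cong x (-1/2) 1"
  shows "padic_least_residue x = (CARD('p) - 1) div 2"
proof -
  obtain m where CARD_eq: "CARD('p) = 2 * m + 1"
    using assms(1) by (rule oddE)
  have "(of_nat m :: 'p padic) = -1/2 + of_nat CARD('p) ^ 1 * (1/2)"
    by (simp add: CARD_eq field_simps)
  then have "padic_cong (of_nat m :: 'p padic) (-1/2) 1"
    unfolding padic_cong_iff using half_padic_Ints[OF assms(1)] by blast
  then have "padic_cong x (of_nat m) 1"
    using assms(2) by (blast intro: padic_cong_trans padic_cong_sym)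
  then have "padic_least_residue x = m"
    by (rule padic_least_residue_unique) (simp add: CARD_eq)
  then show ?thesis
    by (simp add: CARD_eq)
qed

lemma Legendre_minus_1:
  assumes "prime p" "odd p"
  shows "Legendre (-1) (int p) = (-1) ^ ((p - 1) div 2)"
proof -
  have p_gt_2: "p > 2"
    using assms prime_ge_2_nat[of p] by (cases "p = 2") auto
  then have "[Legendre (-1) (int p) = (-1) ^ ((p - 1) div 2)] (mod int p)"
    using euler_criterion[of p "-1"] assms by simp
  moreover have "Legendre (-1) (int p) \<in> {1, -1}"
    using p_gt_2 by (auto simp: Legendre_def cong_iff_dvd_diff dest: zdvd_imp_le)
  moreover have "(-1) ^ ((p - 1) div 2) \<in> {1, -1 :: int}"
    by (simp add: minus_one_power_iff)
  ultimately show ?thesis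
    using p_gt_2 zdvd_not_zless[of 2 "int p"] by (auto simp: cong_iff_dvd_diff)
qed

lemma sum_dpoly_square_cong_Legendre:
  fixes x :: "'p :: prime_card padic"
  assumes "odd CARD('p)" "padic_cong x (-1/2) 1"
  shows "padic_cong (\<Sum>k<CARD('p). (dpoly k x)\<^sup>2) (of_int (Legendre (-1) (int CARD('p)))) 2"
proof -
  have half_Ints: "-1/2 \<in> (padic_Ints :: 'p padic set)"
    using padic_Ints_minus[OF half_padic_Ints[OF assms(1)]] by simp
  with assms(2) have x_Ints: "x \<in> padic_Ints"
    by (rule padic_cong_imp_Ints)
  have "padic_cong ((dpoly k x)\<^sup>2) ((-1) ^ k * (dpoly k x)\<^sup>2) 2" if "k < CARD('p)" for k
  proof (cases "even k")
    case False
    then have "padic_cong (dpoly k x) 0 1"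
      using dpoly_padic_cong[OF assms(2) x_Ints half_Ints that]
        dpoly_minus_half_odd[of k, where 'a = "'p padic"] by simp
    then have "padic_cong ((dpoly k x)\<^sup>2) 0 2" "padic_cong ((-1) ^ k * (dpoly k x)\<^sup>2) ((-1) ^ k * 0) 2"
      by (blast intro: padic_cong_power2_0 padic_cong_scalar_left padic_Ints_closed padic_Ints_power)+
    then show ?thesis
      by (auto intro: padic_cong_trans padic_cong_sym)
  qed simp
  then have "padic_cong (\<Sum>k<CARD('p). (dpoly k x)\<^sup>2) (\<Sum>k<CARD('p). (-1) ^ k * (dpoly k x)\<^sup>2) 2"
    by (intro padic_cong_sum) simp
  from padic_cong_trans[OF this sum_alternating_dpoly_square_cong[OF assms(1) x_Ints]] show ?thesis
    using Legendre_minus_1[OF prime_card assms(1)] padic_least_residue_minus_half[OF assms] by simp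
qed

lemma sum_dpoly_square_cong:
  fixes x :: "'p :: prime_card padic"
  assumes "odd CARD('p)" "x \<in> padic_Ints" "\<not> padic_cong x (-1/2) 1"
  shows "padic_cong (\<Sum>k<CARD('p). (dpoly k x)\<^sup>2)
    ((-1) ^ padic_least_residue x *
      ((of_nat CARD('p) + 2 * x - 2 * of_nat (padic_least_residue x)) / (2 * x + 1))) 2"
    (is "padic_cong ?G (?s * (?c / _)) 2")
proof (rule padic_cong_mult_lcancel)
  show "\<not> padic_cong (2 * x + 1) 0 1"
    using assms padic_cong_minus_half_iff by blast
  then have "2 * x + 1 \<noteq> 0"
    by auto
  have CARD_0: "padic_cong (of_nat CARD('p) :: 'p padic) 0 1"
    by (simp only: padic_cong_of_nat_0_iff dvd_refl)
  have numerator_eq: "of_nat CARD('p) * (1 + 2 * padic_quotient x) = ?c"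
    by (simp add: distrib_left mult.left_commute[of _ 2] CARD_mult_padic_quotient right_diff_distrib)
  have "(2 * x + 1) * ?G = of_nat CARD('p) * (dpoly CARD('p) x * dpoly (CARD('p) - 1) x)"
    by (simp only: sum_dpoly_square mult.assoc)
  also have "padic_cong \<dots> (of_nat CARD('p) * ((1 + 2 * padic_quotient x) * ?s)) (1 + 1)"
    using assms(1,2)
    by (intro padic_cong_0_scalar_left CARD_0 padic_cong_mult dpoly_CARD_cong dpoly_CARD_minus_1_cong) auto
  also have "of_nat CARD('p) * ((1 + 2 * padic_quotient x) * ?s) = ?c * ?s"
    unfolding mult.assoc[symmetric] by (simp only: numerator_eq)
  also have "\<dots> = (2 * x + 1) * (?s * (?c / (2 * x + 1)))"
    using \<open>2 * x + 1 \<noteq> 0\<close> by simp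
  finally show "padic_cong ((2 * x + 1) * ?G) ((2 * x + 1) * (?s * (?c / (2 * x + 1)))) 2"
    by (simp only: one_add_one)
qed (use assms(2) in auto)

subsection \<open>The weighted sum of squares\<close>

lemma dpoly_diff_CARD_square_cong:
  fixes x :: "'p :: prime_card padic"
  assumes "odd CARD('p)" "x \<in> padic_Ints"
  shows "padic_cong ((x + 1) * (dpoly_diff CARD('p) x)\<^sup>2)
    (if padic_cong x (-1) 1 then 4 * (x + 1) else 0) 2"
proof (cases "padic_cong x (-1) 1")
  case True
  have "padic_cong ((dpoly_diff CARD('p) x)\<^sup>2) (2\<^sup>2) 1"
    using dpoly_diff_CARD_cong_2[OF assms(1) True] padic_cong_imp_Ints
    by (intro padic_cong_power2) blast+
  with True have "padic_cong ((x + 1) * (dpoly_diff CARD('p) x)\<^sup>2) ((x + 1) * 2\<^sup>2) (1 + 1)"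
    unfolding padic_cong_minus_1_iff by (intro padic_cong_0_scalar_left)
  then show ?thesis
    unfolding one_add_one using True by (simp add: mult.commute)
next
  case False
  then have "padic_cong ((x + 1) * (dpoly_diff CARD('p) x)\<^sup>2) ((x + 1) * 0) 2"
    using assms by (intro padic_cong_scalar_left padic_cong_power2_0 dpoly_diff_CARD_cong_0) simp_all
  then show ?thesis
    using False by simp
qed

lemma sum_odd_weighted_dpoly_square_cong:
  fixes x :: "'p :: prime_card padic"
  assumes "odd CARD('p)" "x \<in> padic_Ints"
  shows "padic_cong (\<Sum>k<CARD('p). of_nat (2 * k + 1) * (dpoly k x)\<^sup>2)
    (if padic_cong x 0 1 then - x else if padic_cong x (-1) 1 then x + 1 else 0) 2"
    (is "padic_cong ?H ?h 2")
proof -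
  have disjoint: "\<not> (padic_cong x 0 1 \<and> padic_cong x (-1) 1)"
    using padic_cong_diff[of x 0 1 x "-1"] padic_of_nat_not_cong_0[where 'p = 'p, of 1]
      prime_gt_1_nat[OF prime_card[where 'a = 'p]] by (auto dest: padic_cong_sym)
  have "2 * (2 * ?H) = (x + 1) * (dpoly_diff CARD('p) x)\<^sup>2 - x * (dpoly_diff CARD('p) (x - 1))\<^sup>2"
    using sum_odd_weighted_dpoly_square[of x "CARD('p)"] by (simp only: mult.assoc[symmetric]) simp
  also have "padic_cong \<dots>
      ((if padic_cong x (-1) 1 then 4 * (x + 1) else 0) - (if padic_cong x 0 1 then 4 * x else 0)) 2"
    using dpoly_diff_CARD_square_cong[OF assms] dpoly_diff_CARD_square_cong[OF assms(1), of "x - 1"]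
      assms(2) by (intro padic_cong_diff)
        (simp_all only: padic_cong_minus_1_iff diff_add_cancel padic_Ints_closed)
  also have "(if padic_cong x (-1) 1 then 4 * (x + 1) else 0) - (if padic_cong x 0 1 then 4 * x else 0) =
      2 * (2 * ?h)"
    using disjoint by (auto simp: algebra_simps)
  finally show ?thesis
    using padic_2_not_cong_0[OF assms(1)] padic_Ints_numeral by (blast intro: padic_cong_mult_lcancel)
qed

theorem theorem1p2:
  fixes x :: "'p :: prime_card padic" and p :: nat
  assumes "p = CARD('p)" and "odd p" and "x \<in> padic_Ints"
  shows
    "(\<Sum>k=0..p-1. (-1) ^ k * (dpoly k x)\<^sup>2) = (\<Sum>k=0..p-1. dpoly k x * dpoly k (-1 - x)) \<and>
     padic_cong (\<Sum>k=0..p-1. dpoly k x * dpoly k (-1 - x)) ((-1) ^ padic_least_residue x) 2 \<and>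
     (\<Sum>k=0..p-1. (dpoly k x)\<^sup>2) = (\<Sum>k=0..p-1. (-1) ^ k * dpoly k x * dpoly k (-1 - x)) \<and>
     padic_cong (\<Sum>k=0..p-1. (-1) ^ k * dpoly k x * dpoly k (-1 - x))
       (if padic_cong x (-1/2) 1 then of_int (Legendre (-1) (int p))
        else (-1) ^ padic_least_residue x *
          ((of_nat p + 2 * x - 2 * of_nat (padic_least_residue x)) / (2 * x + 1))) 2 \<and>
     padic_cong (\<Sum>k=0..p-1. of_nat (2 * k + 1) * (dpoly k x)\<^sup>2)
       (if padic_cong x 0 1 then - x
        else if padic_cong x (-1) 1 then x + 1
        else 0) 2"
proof -
  have odd: "odd CARD('p)"
    using assms(1,2) by simp
  have range: "{0..p-1} = {..<p}"
    using odd_pos[OF assms(2)] by auto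
  have alternating: "dpoly k x * dpoly k (-1 - x) = (-1) ^ k * (dpoly k x)\<^sup>2"
    and plain: "(-1) ^ k * dpoly k x * dpoly k (-1 - x) = (dpoly k x)\<^sup>2" for k
    by (simp_all add: dpoly_reflect power2_eq_square minus_one_power_iff)
  show ?thesis
    unfolding range alternating plain unfolding assms(1)
    using sum_alternating_dpoly_square_cong[OF odd assms(3)]
      sum_dpoly_square_cong_Legendre[OF odd, of x] sum_dpoly_square_cong[OF odd assms(3)]
      sum_odd_weighted_dpoly_square_cong[OF odd assms(3)]
    by simp
qed

end
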